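(* Let $\mathbf{f} = (f_1,\dots,f_n)$ be a vector of real polynomials in $\mathbf{x} = (x_1,\dots,x_n)$ with $\mathbf{f}(\mathbf{0}) = \mathbf{0}$, and consider the system $\dot{\mathbf{x}}(t) = \mathbf{f}(\mathbf{x}(t))$, $\mathbf{x}(t_0) = \mathbf{x}_0$. Let $\mathbb{GEN} \subseteq \mathbb{R}[\mathbf{x}]$ be an arbitrary certificate of nonnegativity, and let $p_1, p_2 \in \mathbb{R}[\mathbf{x}]$ be strictly positive on $\mathbb{R}^n \setminus \{\mathbf{0}\}$. The equilibrium $\mathbf{x}^\ast = \mathbf{0}$ of the system is stable if there exists a polynomial function $V : \mathbb{R}^n \to \mathbb{R}$ such that $$V(\mathbf{0}) = 0, \qquad V - p_1 \in \mathbb{GEN}, \qquad -\dot V \in \mathbb{GEN}.$$ If furthermore $-\dot V - p_2 \in \mathbb{GEN}$, then $\mathbf{x}^\ast = \mathbf{0}$ is asymptotically stable.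
   Context: A certificate of nonnegativity is a set $\mathbb{GEN}$ of real polynomials such that membership $p \in \mathbb{GEN}$ implies $p(\mathbf{x}) \ge 0$ for all $\mathbf{x} \in \mathbb{R}^n$ (for example, the set of sums of squares). For a polynomial $V$, $\dot V(\mathbf{x}) = \sum_{i=1}^n \frac{\partial V}{\partial x_i}(\mathbf{x}) f_i(\mathbf{x})$ denotes the derivative of $V$ along the system. An equilibrium $\mathbf{x}^\ast$ is stable if for every $\epsilon > 0$ there is $\delta > 0$ such that $\|\mathbf{x}_0 - \mathbf{x}^\ast\| < \delta$ implies $\|\mathbf{x}(t) - \mathbf{x}^\ast\| < \epsilon$ for all $t \ge 0$. It is asymptotically stable if it is stable and $\delta$ can be chosen such that $\|\mathbf{x}_0 - \mathbf{x}^\ast\| < \delta$ implies $\lim_{t \to \infty} \mathbf{x}(t) = \mathbf{x}^\ast$. *)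

theory Defs
  imports "HOL-Analysis.Analysis"
begin

text \<open>
  Elements of the polynomial ring in the coordinates of \<^typ>\<open>real ^ 'n\<close> are identified with the
  polynomial functions they induce (the identification is injective over the reals). On this
  space \<^const>\<open>real_polynomial_function\<close> is the closure of the constants and linear forms under
  sums and products.
\<close>

definition nonnegativity_certificate :: "((real ^ 'n) \<Rightarrow> real) set \<Rightarrow> bool" where
  "nonnegativity_certificate GEN \<longleftrightarrow>
     (\<forall>p\<in>GEN. real_polynomial_function p \<and> (\<forall>x. 0 \<le> p x))"

definition partial_derivative :: "'n \<Rightarrow> ((real ^ 'n) \<Rightarrow> real) \<Rightarrow> real ^ 'n \<Rightarrow> real" where
  "partial_derivative i V x = deriv (\<lambda>s. V (x + s *\<^sub>R axis i 1)) 0"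

definition derivative_along ::
  "(real ^ 'n \<Rightarrow> real ^ 'n) \<Rightarrow> ((real ^ 'n) \<Rightarrow> real) \<Rightarrow> real ^ 'n \<Rightarrow> real" where
  "derivative_along f V x = (\<Sum>i\<in>UNIV. partial_derivative i V x * f x $ i)"

definition solution ::
  "(real ^ 'n \<Rightarrow> real ^ 'n) \<Rightarrow> real \<Rightarrow> real ^ 'n \<Rightarrow> (real \<Rightarrow> real ^ 'n) \<Rightarrow> bool" where
  "solution f t0 x0 x \<longleftrightarrow>
     x t0 = x0 \<and> (\<forall>t\<ge>t0. (x has_vector_derivative f (x t)) (at t within {t0..}))"

text \<open>
  Stability speaks about the trajectory at all times from \<open>t0\<close> on, so it includes that a solution
  starting close to the equilibrium exists for all these times; quantifying only over global
  solutions would be vacuous for initial values whose solution blows up in finite time.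
\<close>

definition stable_equilibrium ::
  "(real ^ 'n \<Rightarrow> real ^ 'n) \<Rightarrow> real \<Rightarrow> real ^ 'n \<Rightarrow> bool" where
  "stable_equilibrium f t0 xs \<longleftrightarrow>
     (\<forall>\<epsilon>>0. \<exists>\<delta>>0. \<forall>x0. norm (x0 - xs) < \<delta> \<longrightarrow>
        (\<exists>x. solution f t0 x0 x) \<and>
        (\<forall>x. solution f t0 x0 x \<longrightarrow> (\<forall>t\<ge>t0. norm (x t - xs) < \<epsilon>)))"

definition asymptotically_stable_equilibrium ::
  "(real ^ 'n \<Rightarrow> real ^ 'n) \<Rightarrow> real \<Rightarrow> real ^ 'n \<Rightarrow> bool" where
  "asymptotically_stable_equilibrium f t0 xs \<longleftrightarrow>
     stable_equilibrium f t0 xs \<and>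
     (\<exists>\<delta>>0. \<forall>x0. norm (x0 - xs) < \<delta> \<longrightarrow>
        (\<exists>x. solution f t0 x0 x) \<and>
        (\<forall>x. solution f t0 x0 x \<longrightarrow> (x \<longlongrightarrow> xs) at_top))"

end

theory Submission
  imports Defs
begin

text \<open>
  \<open>V\<close> is a Lyapunov function: certificates give \<open>V \<ge> p1 > 0\<close> off the origin and make \<open>V\<close> decrease
  along trajectories, so a trajectory starting where \<open>V\<close> is below its minimum on a sphere cannot
  cross that sphere. Such trajectories exist for all times: retracting space onto the ball turns
  \<open>f\<close> into a globally Lipschitz field, whose solution exists globally, stays in the ball by the same
  argument, and hence solves the original system. If \<open>V\<close> decreases at rate at least \<open>p2\<close>, a
  trajectory avoiding a neighbourhood of the origin would make \<open>V\<close> negative, so it enters every such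
  neighbourhood, and by stability it remains close to the origin afterwards.
\<close>

subsection \<open>Global solutions of Lipschitz systems\<close>

text \<open>The fundamental theorem on the compact interval \<open>{a..t + 1}\<close> suffices:
  \<open>t\<close> lies strictly below its right end, so near \<open>t\<close> it agrees with the
  half-line.\<close>

lemma integral_has_vector_derivative_atLeast:
  fixes h :: "real \<Rightarrow> 'a::banach"
  assumes "continuous_on {a..} h" and "a \<le> t"
  shows "((\<lambda>u. integral {a..u} h) has_vector_derivative h t) (at t within {a..})"
proof -
  have "((\<lambda>u. integral {a..u} h) has_vector_derivative h t) (at t within {a..t + 1})"
    by (rule integral_has_vector_derivative)
      (use assms in \<open>auto intro: continuous_on_subset\<close>)
  moreover have "at t within {a..t + 1} = at t within {a..}"
    by (rule at_within_nhd[of _ "{..<t + 1}"]) auto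
  ultimately show ?thesis by simp
qed

text \<open>Integrating the exponential gains the factor \<open>1 / c\<close>, and the weight
  cancels its growth at the upper end. The bound is therefore uniform in \<open>t\<close>; it yields
  both boundedness and contraction of the weighted Picard operator.\<close>

lemma norm_exp_weighted_integral_le:
  fixes h :: "real \<Rightarrow> 'a::banach"
  assumes "0 < c" and "a \<le> t" and "continuous_on {a..t} h"
    and bound: "\<And>s. s \<in> {a..t} \<Longrightarrow> norm (h s) \<le> K * exp (c * (s - a))"
  shows "norm (exp (- (c * (t - a))) *\<^sub>R integral {a..t} h) \<le> K / c"
proof -
  have "0 \<le> K"
    using order_trans[OF norm_ge_zero bound[of a]] \<open>a \<le> t\<close> by simp
  have "((\<lambda>s. K * exp (c * (s - a))) has_integral
      K / c * exp (c * (t - a)) - K / c * exp (c * (a - a))) {a..t}"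
    using \<open>0 < c\<close> \<open>a \<le> t\<close>
    by (intro fundamental_theorem_of_calculus)
      (auto intro!: derivative_eq_intros simp flip: has_real_derivative_iff_has_vector_derivative)
  moreover have "h integrable_on {a..t}"
    by (intro integrable_continuous_real assms)
  ultimately have "norm (integral {a..t} h) \<le> K / c * exp (c * (t - a)) - K / c * exp (c * (a - a))"
    using integral_norm_bound_integral[of h "{a..t}" "\<lambda>s. K * exp (c * (s - a))"] bound
    by (metis has_integral_integrable_integral)
  also have "\<dots> \<le> K / c * exp (c * (t - a))"
    using \<open>0 \<le> K\<close> \<open>0 < c\<close> by simp
  finally have "exp (- (c * (t - a))) * norm (integral {a..t} h)
      \<le> exp (- (c * (t - a))) * (K / c * exp (c * (t - a)))"
    by (intro mult_left_mono) auto
  also have "\<dots> = K / c"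
    by (simp add: exp_minus)
  finally show ?thesis by simp
qed

text \<open>
  Writing a solution as \<open>x0 + exp (c (t - t0)) y t\<close> with \<open>y\<close> bounded turns the Picard operator into
  a contraction with factor \<open>L / c\<close> on the whole half-line, so no gluing of local solutions is needed.
\<close>

lemma lipschitz_imp_solution:
  fixes g :: "real ^ 'n \<Rightarrow> real ^ 'n"
  assumes lip: "L-lipschitz_on UNIV g"
  shows "\<exists>x. solution g t0 x0 x"
proof -
  \<comment> \<open>This choice gives \<open>L / c < 1\<close> and keeps \<open>c\<close> positive
    even for \<open>L = 0\<close>.\<close>
  define c where "c = L + 1"
  have "0 \<le> L" using lip by (rule lipschitz_on_nonneg)
  then have "0 < c" by (simp add: c_def)
  have cont_g: "continuous_on S g" for S
    using lipschitz_on_continuous_on[OF lip] continuous_on_subset by blast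
  define X where "X y t = x0 + exp (c * (t - t0)) *\<^sub>R apply_bcontfun y t" for y t
  define J where "J y t = integral {t0..t} (\<lambda>s. g (X y s))" for y t
  \<comment> \<open>Bounded continuous functions live on the whole real line, so \<open>max\<close>
    extends the operator continuously to the left of \<open>t0\<close>, where it vanishes.\<close>
  define T where "T y t = exp (- (c * (max t t0 - t0))) *\<^sub>R J y (max t t0)" for y t
  have cont_gX: "continuous_on S (\<lambda>s. g (X y s))" for S y
    unfolding X_def by (intro continuous_on_compose2[OF cont_g[of UNIV]] continuous_intros) auto
  have J_deriv: "(J y has_vector_derivative g (X y t)) (at t within {t0..})" if "t0 \<le> t" for y t
    unfolding J_def by (rule integral_has_vector_derivative_atLeast[OF cont_gX that])
  have cont_J: "continuous_on {t0..} (J y)" for y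
    by (auto simp: continuous_on_eq_continuous_within intro!: has_vector_derivative_continuous J_deriv)
  have cont_T: "continuous_on UNIV (T y)" for y
    unfolding T_def by (intro continuous_intros continuous_on_compose2[OF cont_J]) auto
  have norm_T: "norm (T y t) \<le> (norm (g x0) + L * norm y) / c" for y t
    unfolding T_def J_def
  proof (intro norm_exp_weighted_integral_le \<open>0 < c\<close> cont_gX)
    fix s assume s: "s \<in> {t0..max t t0}"
    have "norm (g (X y s)) \<le> norm (g x0) + norm (g (X y s) - g x0)"
      by norm
    also have "\<dots> \<le> norm (g x0) + L * norm (X y s - x0)"
      using lipschitz_on_normD[OF lip] by auto
    also have "\<dots> \<le> norm (g x0) * exp (c * (s - t0)) + L * (norm y * exp (c * (s - t0)))"
    proof (intro add_mono mult_left_mono \<open>0 \<le> L\<close>)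
      show "norm (X y s - x0) \<le> norm y * exp (c * (s - t0))"
        using norm_bounded[of y s] by (simp add: X_def mult.commute)
      show "norm (g x0) \<le> norm (g x0) * exp (c * (s - t0))"
        using s \<open>0 < c\<close> by (simp add: mult_le_cancel_left1)
    qed
    finally show "norm (g (X y s)) \<le> (norm (g x0) + L * norm y) * exp (c * (s - t0))"
      by (simp add: algebra_simps)
  qed auto
  define P where "P y = Bcontfun (T y)" for y
  have P: "apply_bcontfun (P y) = T y" for y
    unfolding P_def by (intro Bcontfun_inverse bcontfun_normI[OF cont_T norm_T])
  have "dist (P y) (P z) \<le> L / c * dist y z" for y z
  proof (rule dist_bound)
    fix t
    let ?h = "\<lambda>s. g (X y s) - g (X z s)"
    have "dist (P y t) (P z t) = norm (T y t - T z t)"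
      by (simp add: P dist_norm)
    also have "T y t - T z t = exp (- (c * (max t t0 - t0))) *\<^sub>R integral {t0..max t t0} ?h"
      unfolding T_def J_def
      by (subst integral_diff)
        (auto intro!: integrable_continuous_real cont_gX simp: scaleR_diff_right)
    also have "norm \<dots> \<le> (L * dist y z) / c"
    proof (intro norm_exp_weighted_integral_le \<open>0 < c\<close> continuous_intros cont_gX)
      fix s
      have "norm (?h s) \<le> L * norm (X y s - X z s)"
        using lipschitz_on_normD[OF lip] by auto
      also have "X y s - X z s = exp (c * (s - t0)) *\<^sub>R (y s - z s)"
        by (simp add: X_def scaleR_diff_right)
      also have "L * norm \<dots> \<le> L * (exp (c * (s - t0)) * dist y z)"
        using dist_bounded[of y s z] \<open>0 \<le> L\<close> by (intro mult_left_mono) (simp_all add: dist_norm)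
      finally show "norm (?h s) \<le> (L * dist y z) * exp (c * (s - t0))"
        by (simp add: mult_ac)
    qed auto
    finally show "dist (P y t) (P z t) \<le> L / c * dist y z" by simp
  qed
  moreover have "0 \<le> L / c" "L / c < 1"
    using \<open>0 \<le> L\<close> by (auto simp: c_def)
  ultimately obtain y where y: "P y = y"
    using banach_fix_type[of "L / c" P] by blast
  \<comment> \<open>On the half-line the factor in \<open>X\<close> undoes the weight in
    \<open>T\<close>, so the fixed point satisfies the integral equation.\<close>
  have X_eq: "X y t = x0 + J y t" if "t0 \<le> t" for t
  proof -
    have "apply_bcontfun y t = T y t" using P[of y] y by simp
    then show ?thesis using that by (simp add: X_def T_def exp_minus)
  qed
  have "(X y has_vector_derivative g (X y t)) (at t within {t0..})" if "t0 \<le> t" for t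
  proof (rule has_vector_derivative_transform)
    show "((\<lambda>t. x0 + J y t) has_vector_derivative g (X y t)) (at t within {t0..})"
      using J_deriv[OF that] by (auto intro!: derivative_eq_intros)
  qed (use that X_eq in auto)
  moreover have "X y t0 = x0"
    using X_eq[of t0] by (simp add: J_def)
  ultimately have "solution g t0 x0 (X y)"
    by (simp add: solution_def)
  then show ?thesis by blast
qed

subsection \<open>Lyapunov functions\<close>

lemma has_real_derivative_along_curve:
  fixes x :: "real \<Rightarrow> 'a::real_normed_vector" and V :: "'a \<Rightarrow> real"
  assumes "(x has_vector_derivative v) (at t within S)"
    and "(V has_derivative V') (at (x t))"
  shows "((\<lambda>s. V (x s)) has_real_derivative V' v) (at t within S)"
proof -
  interpret V': bounded_linear V' using assms(2) by (rule has_derivative_bounded_linear)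
  have "((\<lambda>s. V (x s)) has_derivative (\<lambda>s. V' (s *\<^sub>R v))) (at t within S)"
    using assms by (auto simp: has_vector_derivative_def intro: has_derivative_compose)
  then show ?thesis
    by (simp add: V'.scaleR has_field_derivative_def mult_commute_abs)
qed

text \<open>The mean value theorem applied to \<open>V\<close> along the curve. Confinement uses it
  with \<open>c = 0\<close>, attraction with a positive rate.\<close>

lemma lyapunov_decrease:
  fixes x :: "real \<Rightarrow> 'a::real_normed_vector" and V :: "'a \<Rightarrow> real"
  assumes x: "\<And>t. t0 \<le> t \<Longrightarrow> (x has_vector_derivative g (x t)) (at t within {t0..})"
    and V: "\<And>z. (V has_derivative V' z) (at z)"
    and le: "\<And>t. t \<in> {t0..t1} \<Longrightarrow> V' (x t) (g (x t)) \<le> - c"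
    and "t0 \<le> t1"
  shows "V (x t1) \<le> V (x t0) - c * (t1 - t0)"
proof (cases "t0 = t1")
  case False
  with \<open>t0 \<le> t1\<close> have "t0 < t1" by simp
  have "((\<lambda>s. V (x s)) has_derivative (\<lambda>h. V' (x t) (g (x t)) * h)) (at t within {t0..t1})"
    if "t0 \<le> t" "t \<le> t1" for t
    using has_field_derivative_subset[OF has_real_derivative_along_curve[OF x V], of t "{t0..t1}"] that
    by (auto simp: has_field_derivative_def)
  from mvt_simple[OF \<open>t0 < t1\<close> this] obtain s where "s \<in> {t0<..<t1}"
    and s: "V (x t1) - V (x t0) = V' (x s) (g (x s)) * (t1 - t0)"
    by auto
  then have "V' (x s) (g (x s)) * (t1 - t0) \<le> - c * (t1 - t0)"
    by (intro mult_right_mono le) auto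
  with s show ?thesis by simp
qed simp

text \<open>
  The decrease of \<open>V\<close> is only assumed inside the ball, so the argument has to be made at the first
  time at which the curve meets the sphere.
\<close>

lemma lyapunov_confined:
  fixes x :: "real \<Rightarrow> 'a::real_normed_vector" and V :: "'a \<Rightarrow> real"
  assumes x: "\<And>t. t0 \<le> t \<Longrightarrow> (x has_vector_derivative g (x t)) (at t within {t0..})"
    and V: "\<And>z. (V has_derivative V' z) (at z)"
    and le: "\<And>z. norm z \<le> r \<Longrightarrow> V' z (g z) \<le> 0"
    and sphere: "\<And>z. norm z = r \<Longrightarrow> m \<le> V z"
    and init: "norm (x t0) < r" "V (x t0) < m"
    and "t0 \<le> t"
  shows "norm (x t) < r"
proof (rule ccontr)
  assume nless: "\<not> norm (x t) < r"
  have cont: "continuous_on {t0..} (\<lambda>s. norm (x s))"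
    by (intro continuous_on_norm)
      (auto simp: continuous_on_eq_continuous_within intro!: has_vector_derivative_continuous x)
  \<comment> \<open>Intermediate value theorem: the curve starts inside the sphere and cannot get
    outside without meeting it.\<close>
  have hit: "\<exists>u\<in>{t0..s}. norm (x u) = r" if "t0 \<le> s" "r \<le> norm (x s)" for s
    using IVT'[of "\<lambda>s. norm (x s)" t0 r s] init that continuous_on_subset[OF cont]
    by fastforce
  define S where "S = {t0..t} \<inter> (\<lambda>s. norm (x s)) -` {r}"
  have "S \<noteq> {}"
    using hit[of t] nless \<open>t0 \<le> t\<close> by (auto simp: S_def)
  moreover have "compact S"
    unfolding compact_eq_bounded_closed S_def
    by (auto intro!: continuous_closed_preimage continuous_on_subset[OF cont]
        intro: bounded_subset[OF bounded_closed_interval])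
  ultimately obtain s where "s \<in> S" and first: "\<And>u. u \<in> S \<Longrightarrow> s \<le> u"
    using compact_attains_inf[of S] by auto
  then have s: "t0 \<le> s" "s \<le> t" "norm (x s) = r" by (auto simp: S_def)
  \<comment> \<open>A point outside the ball at time \<open>u\<close> would force a hit no later
    than \<open>u\<close>; minimality of \<open>s\<close> makes that hit, and hence
    \<open>u\<close>, equal to \<open>s\<close>, where the norm is exactly \<open>r\<close>.\<close>
  have "norm (x u) \<le> r" if "u \<in> {t0..s}" for u
  proof (rule ccontr)
    assume "\<not> norm (x u) \<le> r"
    with that hit[of u] obtain w where w: "w \<in> {t0..u}" "norm (x w) = r" by auto
    with that s have "w \<in> S" by (auto simp: S_def)
    then have "w = s" using first[of w] w that by auto
    then show False using w that \<open>\<not> norm (x u) \<le> r\<close> by auto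
  qed
  then have "V (x s) \<le> V (x t0) - 0 * (s - t0)"
    using s le by (intro lyapunov_decrease[OF x V]) auto
  with sphere[of "x s"] s init show False by auto
qed

text \<open>Take \<open>m\<close> to be the minimum of \<open>V\<close> on the sphere, attained by
  compactness and positive. Continuity at the origin then gives \<open>d\<close>; requiring
  \<open>d \<le> r\<close> also puts the starting points inside the sphere.\<close>

lemma lyapunov_trapping_radius:
  fixes V :: "'a::euclidean_space \<Rightarrow> real"
  assumes "continuous_on UNIV V" and "V 0 = 0" and pos: "\<And>z. z \<noteq> 0 \<Longrightarrow> 0 < V z" and "0 < r"
  obtains d m where "0 < d" "d \<le> r" "\<And>z. norm z = r \<Longrightarrow> m \<le> V z" "\<And>z. norm z < d \<Longrightarrow> V z < m"
proof -
  have "continuous_on (sphere 0 r) V"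
    using assms(1) by (rule continuous_on_subset) simp
  moreover have "sphere (0::'a) r \<noteq> {}"
    using \<open>0 < r\<close> by simp
  ultimately obtain w where w: "w \<in> sphere 0 r" "\<And>z. z \<in> sphere 0 r \<Longrightarrow> V w \<le> V z"
    using continuous_attains_inf[OF compact_sphere] by metis
  then have "0 < V w" using \<open>0 < r\<close> by (intro pos) auto
  moreover have "isCont V 0"
    using assms(1) by (simp add: continuous_on_eq_continuous_at)
  ultimately obtain e where "0 < e" "\<And>z. norm z < e \<Longrightarrow> V z < V w"
    using \<open>V 0 = 0\<close> unfolding continuous_at_eps_delta by (force simp: dist_norm)
  with w \<open>0 < r\<close> show thesis
    by (intro that[of "min e r" "V w"]) auto
qed

lemma lipschitz_on_closest_point:
  fixes S :: "'a::euclidean_space set"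
  assumes "convex S" "closed S" "S \<noteq> {}"
  shows "1-lipschitz_on T (closest_point S)"
  using closest_point_lipschitz[OF assms] by (intro lipschitz_onI) auto

lemma lyapunov_solution_exists:
  fixes f :: "real ^ 'n \<Rightarrow> real ^ 'n" and V :: "real ^ 'n \<Rightarrow> real"
  assumes lip: "L-lipschitz_on (cball 0 r) f"
    and V: "\<And>z. (V has_derivative V' z) (at z)"
    and le: "\<And>z. norm z \<le> r \<Longrightarrow> V' z (f z) \<le> 0"
    and sphere: "\<And>z. norm z = r \<Longrightarrow> m \<le> V z"
    and init: "norm x0 < r" "V x0 < m"
  shows "\<exists>x. solution f t0 x0 x"
proof -
  \<comment> \<open>Nearest-point projection onto a closed convex set is 1-Lipschitz, so
    \<open>g\<close> has the constant \<open>L\<close> on the whole space although \<open>f\<close>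
    has it only on the ball.\<close>
  define g where "g z = f (closest_point (cball 0 r) z)" for z
  have ball: "convex (cball (0::real ^ 'n) r)" "closed (cball (0::real ^ 'n) r)"
    "cball (0::real ^ 'n) r \<noteq> {}"
    using le_less_trans[OF norm_ge_zero init(1)] by auto
  have g_eq: "g z = f z" if "norm z \<le> r" for z
    using that by (simp add: g_def closest_point_self)
  have "(L * 1)-lipschitz_on UNIV g"
    unfolding g_def using ball closest_point_in_set[OF ball(2,3)]
    by (intro lipschitz_on_compose2[OF lipschitz_on_closest_point] lipschitz_on_subset[OF lip]) auto
  then obtain x where x: "solution g t0 x0 x"
    using lipschitz_imp_solution by blast
  \<comment> \<open>Confinement asks for decrease only inside the ball, where \<open>g\<close> and
    \<open>f\<close> agree.\<close>
  have "norm (x t) < r" if "t0 \<le> t" for t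
    by (rule lyapunov_confined[where g = g and x = x and ?t0.0 = t0, OF _ V])
      (use x init le sphere that g_eq in \<open>auto simp: solution_def\<close>)
  then have "solution f t0 x0 x"
    using x g_eq unfolding solution_def by (metis less_imp_le)
  then show ?thesis by blast
qed

section \<open>Stability and attraction\<close>

theorem lyapunov_stable:
  fixes f :: "real ^ 'n \<Rightarrow> real ^ 'n" and V :: "real ^ 'n \<Rightarrow> real"
  assumes lip: "\<And>r. \<exists>L. L-lipschitz_on (cball 0 r) f"
    and V: "\<And>z. (V has_derivative V' z) (at z)"
    and "V 0 = 0" and pos: "\<And>z. z \<noteq> 0 \<Longrightarrow> 0 < V z"
    and le: "\<And>z. V' z (f z) \<le> 0"
  shows "stable_equilibrium f t0 0"
  unfolding stable_equilibrium_def
proof (intro allI impI)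
  fix e :: real assume "0 < e"
  have cont: "continuous_on UNIV V"
    by (rule has_derivative_continuous_on) (rule V)
  obtain d m where d: "0 < d" "d \<le> e"
    and m: "\<And>z. norm z = e \<Longrightarrow> m \<le> V z" "\<And>z. norm z < d \<Longrightarrow> V z < m"
    by (rule lyapunov_trapping_radius[OF cont \<open>V 0 = 0\<close> _ \<open>0 < e\<close>]) (blast intro: pos)+
  obtain L where L: "L-lipschitz_on (cball 0 e) f" using lip by blast
  show "\<exists>d>0. \<forall>x0. norm (x0 - 0) < d \<longrightarrow> (\<exists>x. solution f t0 x0 x) \<and>
      (\<forall>x. solution f t0 x0 x \<longrightarrow> (\<forall>t\<ge>t0. norm (x t - 0) < e))"
  proof (intro exI[of _ d] conjI allI impI \<open>0 < d\<close>)
    fix x0 :: "real ^ 'n" assume "norm (x0 - 0) < d"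
    then have x0: "norm x0 < e" "V x0 < m" using d m by auto
    show "\<exists>x. solution f t0 x0 x"
      by (rule lyapunov_solution_exists[OF L V le _ x0]) (rule m(1))
    fix x t assume x: "solution f t0 x0 x" and "t0 \<le> t"
    have "norm (x t) < e"
      by (rule lyapunov_confined[where g = f and x = x and ?t0.0 = t0, OF _ V])
        (use x \<open>t0 \<le> t\<close> le m(1) x0 in \<open>auto simp: solution_def\<close>)
    then show "norm (x t - 0) < e" by simp
  qed
qed

text \<open>Lets the confinement argument begin anew at the time when a trajectory has entered a
  small neighbourhood.\<close>

lemma solution_restart:
  assumes "solution f t0 x0 x" and "t0 \<le> t1"
  shows "solution f t1 (x t1) x"
  unfolding solution_def
proof (intro conjI allI impI refl)
  fix t assume "t1 \<le> t"
  with assms have "(x has_vector_derivative f (x t)) (at t within {t0..})"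
    by (simp add: solution_def)
  then show "(x has_vector_derivative f (x t)) (at t within {t1..})"
    by (rule has_vector_derivative_within_subset) (use \<open>t0 \<le> t1\<close> in simp)
qed

theorem lyapunov_asymptotically_stable:
  fixes f :: "real ^ 'n \<Rightarrow> real ^ 'n" and V W :: "real ^ 'n \<Rightarrow> real"
  assumes lip: "\<And>r. \<exists>L. L-lipschitz_on (cball 0 r) f"
    and V: "\<And>z. (V has_derivative V' z) (at z)"
    and "V 0 = 0" and pos: "\<And>z. z \<noteq> 0 \<Longrightarrow> 0 < V z"
    and le: "\<And>z. V' z (f z) \<le> 0"
    and W: "continuous_on UNIV W" "\<And>z. z \<noteq> 0 \<Longrightarrow> 0 < W z" "\<And>z. V' z (f z) \<le> - W z"
  shows "asymptotically_stable_equilibrium f t0 0"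
proof -
  have stable: "stable_equilibrium f t 0" for t
    by (rule lyapunov_stable[OF lip V \<open>V 0 = 0\<close> pos le])
  \<comment> \<open>Stability with radius 1 keeps the trajectories in the unit ball, which makes the
    annulus considered below compact.\<close>
  from stable[of t0, unfolded stable_equilibrium_def, rule_format, OF zero_less_one]
  obtain d where "0 < d" and d: "\<And>x0. norm x0 < d \<Longrightarrow> \<exists>x. solution f t0 x0 x"
    "\<And>x0 x t. norm x0 < d \<Longrightarrow> solution f t0 x0 x \<Longrightarrow> t0 \<le> t \<Longrightarrow> norm (x t) < 1"
    by auto
  have "(x \<longlongrightarrow> 0) at_top" if "norm x0 < d" and x: "solution f t0 x0 x" for x0 x
    unfolding tendsto_iff
  proof (intro allI impI)
    fix e :: real assume "0 < e"
    have cont: "continuous_on UNIV V"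
      by (rule has_derivative_continuous_on) (rule V)
    obtain d' m where d': "0 < d'" "d' \<le> e"
      and m: "\<And>z. norm z = e \<Longrightarrow> m \<le> V z" "\<And>z. norm z < d' \<Longrightarrow> V z < m"
      by (rule lyapunov_trapping_radius[OF cont \<open>V 0 = 0\<close> _ \<open>0 < e\<close>]) (blast intro: pos)+
    have "\<exists>t1\<ge>t0. norm (x t1) < d'"
    proof (rule ccontr)
      assume "\<not> ?thesis"
      then have annulus: "x t \<in> cball 0 1 - ball 0 d'" if "t0 \<le> t" for t
        using d(2)[OF \<open>norm x0 < d\<close> x that] that by force
      have "compact (cball 0 1 - ball 0 d' :: (real ^ 'n) set)"
        by (intro compact_diff) auto
      \<comment> \<open>\<open>W\<close> attains a minimum on the annulus, which is nonempty because
        it contains \<open>x t0\<close>. This minimum is a uniform rate of decrease.\<close>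
      then obtain w where w: "w \<in> cball 0 1 - ball 0 d'"
        and W_ge: "\<And>z. z \<in> cball 0 1 - ball 0 d' \<Longrightarrow> W w \<le> W z"
        using continuous_attains_inf[of "cball 0 1 - ball 0 d'" W] annulus[of t0] W(1)
        by (metis continuous_on_subset empty_iff order_refl subset_UNIV)
      have "0 < W w" using w \<open>0 < d'\<close> by (intro W) auto
      \<comment> \<open>At rate \<open>W w\<close> the initial value \<open>V (x t0)\<close> is used
        up after time \<open>V (x t0) / W w\<close>; one more time unit brings the bound down to
        \<open>- W w\<close>.\<close>
      define t where "t = t0 + V (x t0) / W w + 1"
      have "0 \<le> V z" for z using pos[of z] \<open>V 0 = 0\<close> by (cases "z = 0") auto
      then have "t0 \<le> t" using \<open>0 < W w\<close> by (simp add: t_def add_increasing2)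
      have "V (x t) \<le> V (x t0) - W w * (t - t0)"
      proof (rule lyapunov_decrease[where g = f, OF _ V _ \<open>t0 \<le> t\<close>])
        show "V' (x s) (f (x s)) \<le> - W w" if "s \<in> {t0..t}" for s
          using W(3)[of "x s"] W_ge[OF annulus, of s] that by auto
      qed (use x in \<open>auto simp: solution_def\<close>)
      also have "\<dots> < 0" using \<open>0 < W w\<close> by (simp add: t_def field_simps)
      finally show False using \<open>\<And>z. 0 \<le> V z\<close>[of "x t"] by simp
    qed
    then obtain t1 where t1: "t0 \<le> t1" "norm (x t1) < d'" by auto
    \<comment> \<open>At \<open>t1\<close> the value of \<open>V\<close> is below its bound
      \<open>m\<close> on the sphere of radius \<open>e\<close>, so confinement restarted there
      holds for all later times.\<close>
    have "norm (x t) < e" if "t1 \<le> t" for t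
      by (rule lyapunov_confined[where g = f and x = x and ?t0.0 = t1, OF _ V])
        (use solution_restart[OF x t1(1)] le m t1 d' that in \<open>auto simp: solution_def\<close>)
    then show "\<forall>\<^sub>F t in at_top. dist (x t) 0 < e"
      by (auto simp: eventually_at_top_linorder)
  qed
  with \<open>0 < d\<close> d stable show ?thesis
    unfolding asymptotically_stable_equilibrium_def by auto
qed

subsection \<open>Polynomial functions\<close>

lemma real_polynomial_function_has_derivative:
  assumes "real_polynomial_function p"
  shows "\<exists>p'. (p has_derivative p') (at x)"
  using assms
proof induction
  case (linear p)
  then show ?case by (blast intro: bounded_linear_imp_has_derivative)
qed (blast intro: derivative_intros)+

text \<open>Induction on the polynomial. Products are the delicate case: a Lipschitz function is
  bounded on a bounded set, and two bounded Lipschitz factors have a Lipschitz product.\<close>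

lemma real_polynomial_function_lipschitz_on_bounded:
  fixes p :: "'a::euclidean_space \<Rightarrow> real"
  assumes "real_polynomial_function p" and "bounded S"
  shows "\<exists>L. L-lipschitz_on S p"
  using assms(1)
proof induction
  case (linear p)
  then interpret bounded_linear p .
  from lipschitz_boundE show ?case by blast
next
  case (mult p q)
  then obtain K L where K: "K-lipschitz_on S p" and L: "L-lipschitz_on S q" by auto
  have "bounded (p ` S)" "bounded (q ` S)"
    by (intro bounded_uniformly_continuous_image[OF _ \<open>bounded S\<close>]
        lipschitz_on_uniformly_continuous[OF K] lipschitz_on_uniformly_continuous[OF L])+
  then obtain A B where A: "\<And>x. x \<in> S \<Longrightarrow> \<bar>p x\<bar> \<le> A" "0 < A" and B: "\<And>x. x \<in> S \<Longrightarrow> \<bar>q x\<bar> \<le> B" "0 < B"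
    by (auto simp: bounded_pos)
  have "dist (p x * q x) (p y * q y) \<le> (A * L + K * B) * dist x y" if "x \<in> S" "y \<in> S" for x y
  proof -
    have "p x * q x - p y * q y = p x * (q x - q y) + (p x - p y) * q y"
      by (simp add: algebra_simps)
    then have "dist (p x * q x) (p y * q y) \<le> \<bar>p x\<bar> * dist (q x) (q y) + dist (p x) (p y) * \<bar>q y\<bar>"
      by (metis abs_mult abs_triangle_ineq dist_real_def)
    also have "\<dots> \<le> A * (L * dist x y) + (K * dist x y) * B"
      using that A B lipschitz_onD[OF K that] lipschitz_onD[OF L that] lipschitz_on_nonneg[OF K]
      by (intro add_mono mult_mono) auto
    finally show ?thesis by (simp add: algebra_simps)
  qed
  then have "(A * L + K * B)-lipschitz_on S (\<lambda>x. p x * q x)"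
    using A B lipschitz_on_nonneg[OF K] lipschitz_on_nonneg[OF L] by (intro lipschitz_onI) auto
  then show ?case ..
qed (blast intro: lipschitz_intros)+

text \<open>The Euclidean norm is at most the sum of the absolute coordinates, so the constants add
  up.\<close>

lemma lipschitz_on_vec:
  fixes f :: "'a::metric_space \<Rightarrow> real ^ 'n"
  assumes "\<And>i. (L i)-lipschitz_on S (\<lambda>x. f x $ i)"
  shows "(\<Sum>i\<in>UNIV. L i)-lipschitz_on S f"
proof (rule lipschitz_onI)
  fix x y assume "x \<in> S" "y \<in> S"
  have "dist (f x) (f y) \<le> (\<Sum>i\<in>UNIV. \<bar>(f x - f y) $ i\<bar>)"
    unfolding dist_norm by (rule norm_le_l1_cart)
  also have "\<dots> \<le> (\<Sum>i\<in>UNIV. L i * dist x y)"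
    using lipschitz_onD[OF assms \<open>x \<in> S\<close> \<open>y \<in> S\<close>] by (intro sum_mono) (simp add: dist_real_def)
  finally show "dist (f x) (f y) \<le> (\<Sum>i\<in>UNIV. L i) * dist x y"
    by (simp add: sum_distrib_right)
qed (auto intro!: sum_nonneg lipschitz_on_nonneg[OF assms])

text \<open>Each partial derivative is \<open>V'\<close> at a coordinate vector, by the chain rule
  along an axis. Linearity then reassembles \<open>f x\<close> from its coordinates, linking the
  coordinate formula to the Frechet derivative.\<close>

lemma derivative_along_eq:
  assumes "(V has_derivative V') (at x)"
  shows "derivative_along f V x = V' (f x)"
proof -
  interpret V': bounded_linear V' using assms by (rule has_derivative_bounded_linear)
  have "partial_derivative i V x = V' (axis i 1)" for i
  proof -
    have "((\<lambda>s. x + s *\<^sub>R axis i 1) has_vector_derivative axis i 1) (at 0)"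
      by (auto intro!: derivative_eq_intros)
    then have "((\<lambda>s. V (x + s *\<^sub>R axis i 1)) has_real_derivative V' (axis i 1)) (at 0)"
      by (rule has_real_derivative_along_curve) (use assms in simp)
    then show ?thesis
      unfolding partial_derivative_def by (rule DERIV_imp_deriv)
  qed
  then have "derivative_along f V x = (\<Sum>i\<in>UNIV. V' (f x $ i *\<^sub>R axis i 1))"
    by (simp add: derivative_along_def V'.scaleR mult.commute)
  also have "\<dots> = V' (\<Sum>i\<in>UNIV. f x $ i *\<^sub>R axis i 1)"
    by (simp add: V'.sum)
  also have "(\<Sum>i\<in>UNIV. f x $ i *\<^sub>R axis i 1) = f x"
    using basis_expansion[of "f x"] by (simp add: scalar_mult_eq_scaleR)
  finally show ?thesis .
qed

section \<open>From certificates to Lyapunov functions\<close>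

theorem theorem3p1:
  fixes f :: "real ^ 'n \<Rightarrow> real ^ 'n"
    and GEN :: "((real ^ 'n) \<Rightarrow> real) set"
    and p1 p2 :: "real ^ 'n \<Rightarrow> real"
    and t0 :: real
  assumes "\<And>i. real_polynomial_function (\<lambda>x. f x $ i)"
    and "f 0 = 0"
    and "nonnegativity_certificate GEN"
    and "real_polynomial_function p1" and "\<And>x. x \<noteq> 0 \<Longrightarrow> 0 < p1 x"
    and "real_polynomial_function p2" and "\<And>x. x \<noteq> 0 \<Longrightarrow> 0 < p2 x"
  shows "((\<exists>V. real_polynomial_function V \<and> V 0 = 0 \<and>
             (\<lambda>x. V x - p1 x) \<in> GEN \<and>
             (\<lambda>x. - derivative_along f V x) \<in> GEN)
           \<longrightarrow> stable_equilibrium f t0 0) \<and>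
         ((\<exists>V. real_polynomial_function V \<and> V 0 = 0 \<and>
             (\<lambda>x. V x - p1 x) \<in> GEN \<and>
             (\<lambda>x. - derivative_along f V x) \<in> GEN \<and>
             (\<lambda>x. - derivative_along f V x - p2 x) \<in> GEN)
           \<longrightarrow> asymptotically_stable_equilibrium f t0 0)"
proof -
  have GEN: "0 \<le> p z" if "p \<in> GEN" for p z
    using assms(3) that by (auto simp: nonnegativity_certificate_def)
  have lip: "\<exists>L. L-lipschitz_on (cball 0 r) f" for r
    using real_polynomial_function_lipschitz_on_bounded[OF assms(1) bounded_cball]
    by (metis lipschitz_on_vec)
  \<comment> \<open>Facts common to both claims: \<open>V \<ge> p1\<close> transfers positivity from
    \<open>p1\<close> to \<open>V\<close>, and the second certificate gives the sign of the
    derivative along \<open>f\<close>.\<close>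
  have lyapunov: "\<exists>V'. (\<forall>z. (V has_derivative V' z) (at z)) \<and> (\<forall>z. z \<noteq> 0 \<longrightarrow> 0 < V z) \<and>
      (\<forall>z. V' z (f z) \<le> 0) \<and> (\<forall>z. derivative_along f V z = V' z (f z))"
    if V: "real_polynomial_function V" "(\<lambda>x. V x - p1 x) \<in> GEN"
      "(\<lambda>x. - derivative_along f V x) \<in> GEN" for V
  proof -
    obtain V' where V': "\<And>z. (V has_derivative V' z) (at z)"
      using real_polynomial_function_has_derivative[OF V(1)] by metis
    show ?thesis
    proof (intro exI[of _ V'] conjI allI impI)
      fix z :: "real ^ 'n"
      show "0 < V z" if "z \<noteq> 0"
        using GEN[OF V(2), of z] assms(5)[OF that] by simp
      show "V' z (f z) \<le> 0"
        using GEN[OF V(3), of z] by (simp add: derivative_along_eq[OF V'])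
    qed (rule V' derivative_along_eq[OF V'])+
  qed
  have cont_p2: "continuous_on UNIV p2"
    using real_polynomial_function_has_derivative[OF assms(6)] has_derivative_continuous
    by (blast intro: continuous_at_imp_continuous_on)
  show ?thesis
  proof (intro conjI impI; elim exE conjE)
    fix V assume V: "real_polynomial_function V" "V 0 = 0" "(\<lambda>x. V x - p1 x) \<in> GEN"
      "(\<lambda>x. - derivative_along f V x) \<in> GEN"
    from lyapunov[OF V(1,3,4)] obtain V' where V': "\<And>z. (V has_derivative V' z) (at z)"
      "\<And>z. z \<noteq> 0 \<Longrightarrow> 0 < V z" "\<And>z. V' z (f z) \<le> 0"
      by auto
    then show "stable_equilibrium f t0 0"
      by (intro lyapunov_stable[OF lip V'(1) V(2) V'(2,3)])
  next
    fix V assume V: "real_polynomial_function V" "V 0 = 0" "(\<lambda>x. V x - p1 x) \<in> GEN"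
      "(\<lambda>x. - derivative_along f V x) \<in> GEN" and p2: "(\<lambda>x. - derivative_along f V x - p2 x) \<in> GEN"
    from lyapunov[OF V(1,3,4)] obtain V' where V': "\<And>z. (V has_derivative V' z) (at z)"
      "\<And>z. z \<noteq> 0 \<Longrightarrow> 0 < V z" "\<And>z. V' z (f z) \<le> 0" "\<And>z. derivative_along f V z = V' z (f z)"
      by auto
    \<comment> \<open>The third certificate makes \<open>p2\<close> a lower bound for the rate of
      decrease, in the role of \<open>W\<close>.\<close>
    have "V' z (f z) \<le> - p2 z" for z
      using GEN[OF p2, of z] V'(4)[of z] by simp
    then show "asymptotically_stable_equilibrium f t0 0"
      by (intro lyapunov_asymptotically_stable[OF lip V'(1) V(2) V'(2,3) cont_p2 assms(7)])
  qed
qed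

end
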